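(* Let $(R,\Longrightarrow)$ be a reduction ring satisfying axiom (A4). Then for every finitely generated ideal $\mathfrak i$ of $R$ the quotient $(R/\mathfrak i,\longrightarrow)$, equipped with the reduction relation $\longrightarrow$ induced from $\Longrightarrow$ (described in the context), is again a reduction ring satisfying (A4).
   Context: $R$ is an associative, not necessarily commutative ring with unit $1$; "ideal" means two-sided ideal, and $\mathrm{ideal}_R(B)$ is the ideal generated by $B$. A reduction relation on $R$ is a family of binary relations $\Longrightarrow_\beta$ on $R$, $\beta\in R$; for $B\subseteq R$ one has a relation $\Longrightarrow_B$. "$\alpha\Longrightarrow_\beta$" means that $\alpha\Longrightarrow_\beta\gamma$ for some $\gamma$. $\stackrel{*}{\Longrightarrow}_B$ is the reflexive transitive closure and $\stackrel{*}{\Longleftrightarrow}_B$ the reflexive symmetric transitive closure. Axioms: (A1) $\Longrightarrow_B=\bigcup_{\beta\in B}\Longrightarrow_\beta$, and $\Longrightarrow_B$ is terminating for every finite $B\subseteq R$. (A2) $\alpha\Longrightarrow_\beta\gamma$ implies $\alpha-\gamma\in\mathrm{ideal}_R(\{\beta\})$. (A3) $\alpha\Longrightarrow_\alpha 0$ for all $\alpha\in R\setminus\{0\}$. (A4) $\alpha\Longrightarrow_\beta$ and $\beta\Longrightarrow_\gamma\delta$ imply $\alpha\Longrightarrow_\gamma$ or $\alpha\Longrightarrow_\delta$. A subset $B\subseteq R$ is a Gröbner basis of $\mathfrak i=\mathrm{ideal}_R(B)$ if $\stackrel{*}{\Longleftrightarrow}_B$ equals the congruence $\equiv_{\mathfrak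 i}$ ($\alpha\equiv_{\mathfrak i}\beta$ iff $\alpha-\beta\in\mathfrak i$) and $\Longrightarrow_B$ is complete (terminating and confluent). $(R,\Longrightarrow)$ satisfying (A1)–(A3) is a reduction ring if every finitely generated ideal has a finite Gröbner basis. Quotient: let $B$ be a finite Gröbner basis of $\mathfrak i$. Every $\alpha\in R$ has a unique normal form $\alpha{\Downarrow}_B$ with respect to $\Longrightarrow_B$. The elements of $R/\mathfrak i$ are represented by the $\Longrightarrow_B$-irreducible elements of $R$, with $\alpha+\beta:=(\alpha+\beta){\Downarrow}_B$ and $\alpha\cdot\beta:=(\alpha\cdot\beta){\Downarrow}_B$. For $\alpha,\beta,\gamma\in R/\mathfrak i$ put $\alpha\longrightarrow_\beta\gamma$ iff there is $\gamma'\in R$ with $\alpha\Longrightarrow_\beta\gamma'$ and $\gamma'{\Downarrow}_B=\gamma$; $\longrightarrow_S=\bigcup_{s\in S}\longrightarrow_s$. *)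

theory Defs
  imports "HOL-Algebra.QuotRing" "HOL-Library.Confluence"
begin

text \<open>A reduction relation is a family \<open>red\<close>, where \<open>red \<beta> \<alpha> \<gamma>\<close> stands for
  \<open>\<alpha> \<Longrightarrow>\<^sub>\<beta> \<gamma>\<close>.\<close>

definition red_set :: "('a \<Rightarrow> 'a \<Rightarrow> 'a \<Rightarrow> bool) \<Rightarrow> 'a set \<Rightarrow> 'a \<Rightarrow> 'a \<Rightarrow> bool" where
  "red_set red B \<alpha> \<gamma> \<longleftrightarrow> (\<exists>\<beta>\<in>B. red \<beta> \<alpha> \<gamma>)"

definition reducible :: "('a \<Rightarrow> 'a \<Rightarrow> bool) \<Rightarrow> 'a \<Rightarrow> bool" where
  "reducible r \<alpha> \<longleftrightarrow> (\<exists>\<gamma>. r \<alpha> \<gamma>)"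

definition terminating :: "('a \<Rightarrow> 'a \<Rightarrow> bool) \<Rightarrow> bool" where
  "terminating r \<longleftrightarrow> wfp (r\<inverse>\<inverse>)"

definition finitely_generated_ideal :: "('a, 'm) ring_scheme \<Rightarrow> 'a set \<Rightarrow> bool" where
  "finitely_generated_ideal R I \<longleftrightarrow> (\<exists>F. finite F \<and> F \<subseteq> carrier R \<and> I = genideal R F)"

definition groebner_basis ::
    "('a, 'm) ring_scheme \<Rightarrow> ('a \<Rightarrow> 'a \<Rightarrow> 'a \<Rightarrow> bool) \<Rightarrow> 'a set \<Rightarrow> 'a set \<Rightarrow> bool" where
  "groebner_basis R red B I \<longleftrightarrow>
     B \<subseteq> carrier R \<and> I = genideal R B \<and>
     (\<forall>\<alpha>\<in>carrier R. \<forall>\<beta>\<in>carrier R. equivclp (red_set red B) \<alpha> \<beta> \<longleftrightarrow> \<alpha> \<ominus>\<^bsub>R\<^esub> \<beta> \<in> I) \<and>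
     terminating (red_set red B) \<and> confluentp (red_set red B)"

text \<open>The equation \<open>\<Longrightarrow>\<^sub>B = (\<Union>\<beta>\<in>B. \<Longrightarrow>\<^sub>\<beta>)\<close> of axiom (A1) holds by definition of
  \<^const>\<open>red_set\<close>.  Indices \<open>\<beta>\<close> outside the carrier are irrelevant.\<close>

locale reduction_relation = ring R for R (structure) +
  fixes red :: "'a \<Rightarrow> 'a \<Rightarrow> 'a \<Rightarrow> bool"
  assumes red_closed:
      "\<lbrakk>\<beta> \<in> carrier R; red \<beta> \<alpha> \<gamma>\<rbrakk> \<Longrightarrow> \<alpha> \<in> carrier R \<and> \<gamma> \<in> carrier R"
    and A1: "\<lbrakk>finite B; B \<subseteq> carrier R\<rbrakk> \<Longrightarrow> terminating (red_set red B)"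
    and A2: "\<lbrakk>\<beta> \<in> carrier R; red \<beta> \<alpha> \<gamma>\<rbrakk> \<Longrightarrow> \<alpha> \<ominus> \<gamma> \<in> Idl {\<beta>}"
    and A3: "\<alpha> \<in> carrier R - {\<zero>} \<Longrightarrow> red \<alpha> \<alpha> \<zero>"

locale reduction_ring = reduction_relation +
  assumes finite_groebner_basis:
    "finitely_generated_ideal R I \<Longrightarrow> \<exists>B. finite B \<and> groebner_basis R red B I"

definition axiom_A4 :: "('a, 'm) ring_scheme \<Rightarrow> ('a \<Rightarrow> 'a \<Rightarrow> 'a \<Rightarrow> bool) \<Rightarrow> bool" where
  "axiom_A4 R red \<longleftrightarrow>
     (\<forall>\<alpha>\<in>carrier R. \<forall>\<beta>\<in>carrier R. \<forall>\<gamma>\<in>carrier R. \<forall>\<delta>\<in>carrier R.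
        reducible (red \<beta>) \<alpha> \<and> red \<gamma> \<beta> \<delta> \<longrightarrow> reducible (red \<gamma>) \<alpha> \<or> reducible (red \<delta>) \<alpha>)"

definition normal_form :: "('a \<Rightarrow> 'a \<Rightarrow> 'a \<Rightarrow> bool) \<Rightarrow> 'a set \<Rightarrow> 'a \<Rightarrow> 'a" where
  "normal_form red B \<alpha> =
     (THE \<gamma>. (red_set red B)\<^sup>*\<^sup>* \<alpha> \<gamma> \<and> \<not> reducible (red_set red B) \<gamma>)"

text \<open>The quotient of \<open>R\<close> by the ideal generated by \<open>B\<close>, realised on normal forms; meaningful when
  \<open>B\<close> is a finite Groebner basis of that ideal.\<close>

definition quotient_ring ::
    "('a, 'm) ring_scheme \<Rightarrow> ('a \<Rightarrow> 'a \<Rightarrow> 'a \<Rightarrow> bool) \<Rightarrow> 'a set \<Rightarrow> 'a ring" where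
  "quotient_ring R red B =
     \<lparr>carrier = {\<alpha> \<in> carrier R. \<not> reducible (red_set red B) \<alpha>},
      mult = (\<lambda>\<alpha> \<beta>. normal_form red B (\<alpha> \<otimes>\<^bsub>R\<^esub> \<beta>)),
      one = normal_form red B \<one>\<^bsub>R\<^esub>,
      zero = normal_form red B \<zero>\<^bsub>R\<^esub>,
      add = (\<lambda>\<alpha> \<beta>. normal_form red B (\<alpha> \<oplus>\<^bsub>R\<^esub> \<beta>))\<rparr>"

definition quotient_red ::
    "('a, 'm) ring_scheme \<Rightarrow> ('a \<Rightarrow> 'a \<Rightarrow> 'a \<Rightarrow> bool) \<Rightarrow> 'a set \<Rightarrow> 'a \<Rightarrow> 'a \<Rightarrow> 'a \<Rightarrow> bool" where
  "quotient_red R red B \<beta> \<alpha> \<gamma> \<longleftrightarrow>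
     \<alpha> \<in> carrier (quotient_ring R red B) \<and> \<beta> \<in> carrier (quotient_ring R red B) \<and>
     \<gamma> \<in> carrier (quotient_ring R red B) \<and>
     (\<exists>\<gamma>'\<in>carrier R. red \<beta> \<alpha> \<gamma>' \<and> normal_form red B \<gamma>' = \<gamma>)"

end

(* The normal form map is a surjective ring homomorphism from R onto the quotient, with kernel I.
   The quotient axioms (A1)-(A3) follow because a quotient step is a step of R followed by a
   B-reduction.  Axiom (A4), applied along a B-reduction, shows that a B-irreducible element
   reducible by g is also reducible by the normal form of g.  Hence, given a Groebner basis G in R
   of the preimage of an ideal J, the normal forms of G have the same irreducible elements in the
   quotient as G has, and confluence modulo J is inherited from G. *)

theory Submission
  imports Defs
begin

section \<open>Terminating and confluent relations\<close>

lemma terminating_asym: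
  assumes "terminating r" "r x y"
  shows "\<not> r y x"
  using wfp_imp_asymp[OF assms(1)[unfolded terminating_def]] assms(2) by (auto dest: asympD)

lemma terminating_reaches_irreducible:
  assumes "terminating r"
  obtains y where "r\<^sup>*\<^sup>* x y" "\<not> reducible r y"
proof -
  have "\<exists>y. r\<^sup>*\<^sup>* x y \<and> \<not> reducible r y"
    using assms unfolding terminating_def
  proof (induction x rule: wfp_induct_rule)
    case (less x)
    show ?case
    proof (cases "reducible r x")
      case True
      then obtain z where z: "r x z" by (auto simp: reducible_def)
      then obtain y where "r\<^sup>*\<^sup>* z y" "\<not> reducible r y" using less.IH by blast
      then show ?thesis using z by (blast intro: converse_rtranclp_into_rtranclp)
    qed blast
  qed
  then show thesis using that by blast
qed

lemma irreducible_rtranclp_eq: "\<lbrakk>r\<^sup>*\<^sup>* x y; \<not> reducible r x\<rbrakk> \<Longrightarrow> y = x"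
  by (auto simp: reducible_def elim: converse_rtranclpE)

text \<open>By confluence, convertible elements are joinable, and an irreducible element reaches
  only itself.\<close>

lemma confluentp_irreducible_unique:
  assumes "confluentp r" "equivclp r x y" "\<not> reducible r x" "\<not> reducible r y"
  shows "x = y"
proof -
  obtain u where "r\<^sup>*\<^sup>* x u" "r\<^sup>*\<^sup>* y u"
    using assms(2)
    unfolding semiconfluentp_equivclp[OF confluentp_imp_semiconfluentp[OF assms(1)]]
      rtranclp_conversep by auto
  with assms(3,4) show ?thesis by (metis irreducible_rtranclp_eq)
qed

section \<open>Images of ideals under surjective homomorphisms\<close>

text \<open>Surjectivity supplies a preimage in \<open>R\<close> for every multiplier from
  \<open>S\<close>, so absorption can be checked in \<open>I\<close>.\<close>

lemma (in ring_hom_ring) surj_image_ideal: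
  assumes "ideal I R" and surj: "h ` carrier R = carrier S"
  shows "ideal (h ` I) S"
proof -
  interpret I: ideal I R by fact
  show ?thesis
  proof (rule idealI[OF S.ring_axioms])
    show "subgroup (h ` I) (add_monoid S)"
      by (rule group_hom.subgroup_img_is_subgroup[OF a_group_hom I.a_subgroup])
    fix a x assume "a \<in> h ` I" "x \<in> carrier S"
    then obtain b y where by_: "b \<in> I" "y \<in> carrier R" "a = h b" "x = h y"
      using surj by (metis imageE)
    then have "x \<otimes>\<^bsub>S\<^esub> a = h (y \<otimes> b)" "a \<otimes>\<^bsub>S\<^esub> x = h (b \<otimes> y)"
      by (auto simp: I.Icarr)
    then show "x \<otimes>\<^bsub>S\<^esub> a \<in> h ` I" "a \<otimes>\<^bsub>S\<^esub> x \<in> h ` I"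
      using by_ I.I_l_closed I.I_r_closed by blast+
  qed
qed

lemma (in ring_hom_ring) surj_image_genideal:
  assumes "A \<subseteq> carrier R" and surj: "h ` carrier R = carrier S"
  shows "h ` (Idl\<^bsub>R\<^esub> A) = Idl\<^bsub>S\<^esub> (h ` A)"
proof
  have hA: "h ` A \<subseteq> carrier S" using assms by blast
  have "Idl\<^bsub>R\<^esub> A \<subseteq> {r \<in> carrier R. h r \<in> Idl\<^bsub>S\<^esub> (h ` A)}"
    using ideal_vimage[OF S.genideal_ideal[OF hA]] S.genideal_self[OF hA] assms(1)
    by (intro R.genideal_minimal) auto
  then show "h ` (Idl\<^bsub>R\<^esub> A) \<subseteq> Idl\<^bsub>S\<^esub> (h ` A)" by blast
  show "Idl\<^bsub>S\<^esub> (h ` A) \<subseteq> h ` (Idl\<^bsub>R\<^esub> A)"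
    using surj_image_ideal[OF R.genideal_ideal surj] assms(1) R.genideal_self[of A]
    by (intro S.genideal_minimal) auto
qed

section \<open>Reduction relations\<close>

context reduction_relation
begin

lemma red_set_closed:
  "\<lbrakk>B \<subseteq> carrier R; red_set red B x y\<rbrakk> \<Longrightarrow> x \<in> carrier R \<and> y \<in> carrier R"
  by (auto simp: red_set_def dest: red_closed)

lemma rtranclp_red_set_closed:
  assumes "B \<subseteq> carrier R" "(red_set red B)\<^sup>*\<^sup>* x y" "x \<in> carrier R"
  shows "y \<in> carrier R"
  using assms(2,3) by (induction rule: rtranclp_induct) (auto dest: red_set_closed[OF assms(1)])

text \<open>A step \<open>0 \<Longrightarrow>\<^sub>\<beta> \<gamma>\<close> would, together with (A3) for \<open>\<gamma>\<close>, form a cycle.\<close>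

lemma zero_irreducible:
  assumes "\<beta> \<in> carrier R"
  shows "\<not> red \<beta> \<zero> \<gamma>"
proof
  assume r: "red \<beta> \<zero> \<gamma>"
  then have \<gamma>: "\<gamma> \<in> carrier R" using red_closed assms by blast
  have t: "terminating (red_set red {\<beta>, \<gamma>})" using A1 assms \<gamma> by simp
  have s: "red_set red {\<beta>, \<gamma>} \<zero> \<gamma>" using r by (simp add: red_set_def)
  have "red_set red {\<beta>, \<gamma>} \<gamma> \<zero>"
  proof (cases "\<gamma> = \<zero>")
    case True
    then show ?thesis using s by simp
  next
    case False
    then show ?thesis using A3 \<gamma> by (auto simp: red_set_def)
  qed
  with terminating_asym[OF t s] show False by blast
qed

lemma zero_irreducible_set: "B \<subseteq> carrier R \<Longrightarrow> \<not> reducible (red_set red B) \<zero>"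
  using zero_irreducible by (auto simp: reducible_def red_set_def)

text \<open>For one step from \<open>y\<close> to \<open>z\<close> by some \<open>b\<close> in
  \<open>B\<close>, (A4) makes \<alpha> reducible by \<open>b\<close> or by \<open>z\<close>. The
  first is excluded because \<alpha> is \<open>B\<close>-irreducible, so reducibility passes along
  the whole chain.\<close>

lemma A4_reducible_descends:
  assumes A4: "axiom_A4 R red" and B: "B \<subseteq> carrier R" and "\<alpha> \<in> carrier R" "\<beta> \<in> carrier R"
    and irred: "\<not> reducible (red_set red B) \<alpha>"
    and "(red_set red B)\<^sup>*\<^sup>* \<beta> \<delta>" "reducible (red \<beta>) \<alpha>"
  shows "reducible (red \<delta>) \<alpha>"
  using assms(6,7,4)
proof (induction rule: converse_rtranclp_induct)
  case (step y z)
  from step.hyps(1) obtain b where b: "b \<in> B" "red b y z" by (auto simp: red_set_def)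
  have z: "z \<in> carrier R" using red_set_closed[OF B step.hyps(1)] by simp
  have "\<not> reducible (red b) \<alpha>" using irred b by (auto simp: reducible_def red_set_def)
  then have "reducible (red z) \<alpha>"
    using A4 b step.prems z assms(3) B unfolding axiom_A4_def by blast
  then show ?case using step.IH z by blast
qed

end

section \<open>The quotient by a finite Groebner basis\<close>

locale groebner_quotient = reduction_relation +
  fixes B I
  assumes finite_B: "finite B" and groebner: "groebner_basis R red B I"
begin

section \<open>Normal forms as canonical representatives of cosets\<close>

abbreviation "nf \<equiv> normal_form red B"
abbreviation "Q \<equiv> quotient_ring R red B"
abbreviation "qred \<equiv> quotient_red R red B"

lemma B_carrier: "B \<subseteq> carrier R" and I_eq: "I = Idl B"
  and equivclp_iff:
    "\<lbrakk>x \<in> carrier R; y \<in> carrier R\<rbrakk> \<Longrightarrow> equivclp (red_set red B) x y \<longleftrightarrow> x \<ominus> y \<in> I"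
  and terminating_B: "terminating (red_set red B)"
  and confluent_B: "confluentp (red_set red B)"
  using groebner by (auto simp: groebner_basis_def)

lemma ideal_I: "ideal I R"
  unfolding I_eq by (rule genideal_ideal[OF B_carrier])

text \<open>Termination gives existence and confluence gives uniqueness, so the description in
  \<open>normal_form\<close> denotes. Both properties hold on the whole type, hence no carrier
  assumption on \<open>x\<close>.\<close>

lemma nf_reduces: "(red_set red B)\<^sup>*\<^sup>* x (nf x)"
  and nf_irreducible: "\<not> reducible (red_set red B) (nf x)"
proof -
  obtain y where y: "(red_set red B)\<^sup>*\<^sup>* x y" "\<not> reducible (red_set red B) y"
    using terminating_reaches_irreducible[OF terminating_B] .
  have "\<exists>!y. (red_set red B)\<^sup>*\<^sup>* x y \<and> \<not> reducible (red_set red B) y"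
  proof (rule ex1I)
    show "(red_set red B)\<^sup>*\<^sup>* x y \<and> \<not> reducible (red_set red B) y" using y by simp
    show "z = y" if "(red_set red B)\<^sup>*\<^sup>* x z \<and> \<not> reducible (red_set red B) z" for z
      using that y
      by (metis confluent_B confluentp_irreducible_unique equivclp_sym equivclp_trans
          rtranclp_into_equivclp)
  qed
  from theI'[OF this]
  show "(red_set red B)\<^sup>*\<^sup>* x (nf x)" "\<not> reducible (red_set red B) (nf x)"
    unfolding normal_form_def by auto
qed

lemma nf_closed: "x \<in> carrier R \<Longrightarrow> nf x \<in> carrier R"
  by (rule rtranclp_red_set_closed[OF B_carrier nf_reduces])

lemma carrier_Q: "carrier Q = {x \<in> carrier R. \<not> reducible (red_set red B) x}"
  by (simp add: quotient_ring_def)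

lemma nf_in_Q: "x \<in> carrier R \<Longrightarrow> nf x \<in> carrier Q"
  by (simp add: carrier_Q nf_closed nf_irreducible)

lemma Q_carrier: "x \<in> carrier Q \<Longrightarrow> x \<in> carrier R"
  by (simp add: carrier_Q)

lemma nf_id: "x \<in> carrier Q \<Longrightarrow> nf x = x"
  using irreducible_rtranclp_eq[OF nf_reduces] by (simp add: carrier_Q)

lemma nf_image: "nf ` carrier R = carrier Q"
  using nf_in_Q nf_id Q_carrier by force

lemma nf_eq_iff:
  assumes "x \<in> carrier R" "y \<in> carrier R"
  shows "nf x = nf y \<longleftrightarrow> x \<ominus> y \<in> I"
proof
  assume "nf x = nf y"
  then have "equivclp (red_set red B) x y"
    by (metis nf_reduces rtranclp_into_equivclp equivclp_sym equivclp_trans)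
  then show "x \<ominus> y \<in> I" using equivclp_iff assms by simp
next
  assume "x \<ominus> y \<in> I"
  then have "equivclp (red_set red B) (nf x) (nf y)"
    by (metis assms equivclp_iff nf_reduces rtranclp_into_equivclp equivclp_sym equivclp_trans)
  then show "nf x = nf y"
    using confluentp_irreducible_unique[OF confluent_B] nf_irreducible by blast
qed

section \<open>The quotient ring and the normal form homomorphism\<close>

lemma nf_eq_coset_iff:
  "\<lbrakk>x \<in> carrier R; y \<in> carrier R\<rbrakk> \<Longrightarrow> nf x = nf y \<longleftrightarrow> I +> x = I +> y"
  using nf_eq_iff quotient_eq_iff_same_a_r_cos[OF ideal_I] by simp

lemma coset_nf: "x \<in> carrier R \<Longrightarrow> I +> nf x = I +> x"
  using nf_eq_coset_iff[of "nf x" x] nf_closed nf_id nf_in_Q by simp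

text \<open>The operations of \<open>Q\<close> normalise their results, so each equation compares
  two normal forms. Replacing arguments by their normal forms stays in the same coset of
  \<open>I\<close>, by coset arithmetic.\<close>

lemma nf_hom: "nf \<in> ring_hom R Q"
proof (rule ring_hom_memI)
  interpret I: ideal I R by (rule ideal_I)
  fix x y assume xy: "x \<in> carrier R" "y \<in> carrier R"
  show "nf x \<in> carrier Q" using xy nf_in_Q by simp
  have "I +> (x \<otimes> y) = I +> (nf x \<otimes> nf y)"
    using xy nf_closed by (metis I.rcoset_mult_add coset_nf)
  then show "nf (x \<otimes> y) = nf x \<otimes>\<^bsub>Q\<^esub> nf y"
    using nf_eq_coset_iff xy nf_closed by (simp add: quotient_ring_def)
  have "I +> (x \<oplus> y) = I +> (nf x \<oplus> nf y)"
    using xy nf_closed by (metis I.a_rcos_sum coset_nf)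
  then show "nf (x \<oplus> y) = nf x \<oplus>\<^bsub>Q\<^esub> nf y"
    using nf_eq_coset_iff xy nf_closed by (simp add: quotient_ring_def)
qed (simp add: quotient_ring_def)

lemma ring_Q: "ring Q"
proof -
  \<comment> \<open>The library makes the image of a homomorphism a ring without assuming that the
    target is one; here carrier and zero of that image are already those of
    \<open>Q\<close>.\<close>
  have "Q\<lparr>carrier := nf ` carrier R, zero := nf \<zero>\<rparr> = Q"
    by (simp add: nf_image) (simp add: quotient_ring_def)
  then show ?thesis using ring_hom_imp_img_ring[OF nf_hom] by simp
qed

sublocale nf: ring_hom_ring R Q nf
  by (rule ring_hom_ringI2[OF ring_axioms ring_Q nf_hom])

lemma zero_Q: "\<zero>\<^bsub>Q\<^esub> = \<zero>"
  using zero_irreducible_set[OF B_carrier] nf_id[of \<zero>] by (simp add: carrier_Q)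

lemma nf_minus:
  "\<lbrakk>x \<in> carrier R; y \<in> carrier R\<rbrakk> \<Longrightarrow> nf (x \<ominus> y) = nf x \<ominus>\<^bsub>Q\<^esub> nf y"
  by (simp add: a_minus_def)

lemma nf_I: "x \<in> I \<Longrightarrow> nf x = \<zero>\<^bsub>Q\<^esub>"
  using nf_eq_iff[of x \<zero>] ideal.Icarr[OF ideal_I] by (simp add: minus_eq)

section \<open>The induced reduction relation\<close>

lemma qredE:
  assumes "qred \<beta> \<alpha> \<gamma>"
  obtains \<gamma>' where "\<alpha> \<in> carrier Q" "\<beta> \<in> carrier Q" "\<gamma>' \<in> carrier R" "red \<beta> \<alpha> \<gamma>'" "\<gamma> = nf \<gamma>'"
  using assms unfolding quotient_red_def by blast

text \<open>Normalising the result of a step is always possible, so it never blocks the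
  step.\<close>

lemma reducible_qred_iff:
  assumes "\<alpha> \<in> carrier Q" "\<beta> \<in> carrier Q"
  shows "reducible (qred \<beta>) \<alpha> \<longleftrightarrow> reducible (red \<beta>) \<alpha>"
proof
  assume "reducible (red \<beta>) \<alpha>"
  then obtain \<gamma> where "red \<beta> \<alpha> \<gamma>" by (auto simp: reducible_def)
  moreover from this have "\<gamma> \<in> carrier R" using red_closed Q_carrier assms by blast
  ultimately show "reducible (qred \<beta>) \<alpha>"
    using assms nf_in_Q unfolding reducible_def quotient_red_def by blast
qed (auto simp: reducible_def elim: qredE)

lemma A4_reducible_nf:
  assumes "axiom_A4 R red" "\<alpha> \<in> carrier Q" "\<beta> \<in> carrier R" "reducible (red \<beta>) \<alpha>"
  shows "reducible (red (nf \<beta>)) \<alpha>"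
  using assms A4_reducible_descends[OF assms(1) B_carrier _ _ _ nf_reduces]
  by (auto simp: carrier_Q)

text \<open>A quotient step by \<open>s\<close> unfolds in \<open>R\<close> to a step by
  \<open>s\<close> followed by steps by \<open>B\<close>. This is a nonempty chain for the finite
  set \<open>S \<union> B\<close>, to which (A1) applies.\<close>

lemma qred_set_terminating:
  assumes "finite S" "S \<subseteq> carrier Q"
  shows "terminating (red_set qred S)"
proof -
  let ?r = "red_set red (S \<union> B)"
  have "terminating ?r"
    using assms finite_B B_carrier Q_carrier by (intro A1) auto
  then have "wfp ((?r\<inverse>\<inverse>)\<^sup>+\<^sup>+)" unfolding terminating_def by (rule wfp_tranclp)
  moreover have "(red_set qred S)\<inverse>\<inverse> \<le> (?r\<inverse>\<inverse>)\<^sup>+\<^sup>+"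
  proof (rule predicate2I)
    fix y x assume "(red_set qred S)\<inverse>\<inverse> y x"
    then obtain s y' where s: "s \<in> S" "red s x y'" "y = nf y'"
      by (auto simp: red_set_def elim: qredE)
    have "red_set red B \<le> ?r" by (auto simp: red_set_def)
    then have "?r\<^sup>*\<^sup>* y' y" using nf_reduces[of y'] s(3) by (metis rtranclp_mono predicate2D)
    moreover have "?r x y'" using s by (auto simp: red_set_def)
    ultimately have "?r\<^sup>+\<^sup>+ x y" by (metis rtranclp_into_tranclp2)
    then show "(?r\<inverse>\<inverse>)\<^sup>+\<^sup>+ y x" by (simp add: tranclp_converse)
  qed
  ultimately show ?thesis unfolding terminating_def by (rule wfp_subset)
qed

text \<open>Apply \<open>nf\<close> to the membership given by (A2) in \<open>R\<close>: it fixes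
  \<alpha> and \<beta>, and maps the ideal of \<beta> in \<open>R\<close> onto the one in
  \<open>Q\<close>.\<close>

lemma qred_A2:
  assumes "qred \<beta> \<alpha> \<gamma>"
  shows "\<alpha> \<ominus>\<^bsub>Q\<^esub> \<gamma> \<in> Idl\<^bsub>Q\<^esub> {\<beta>}"
proof -
  obtain \<gamma>' where g: "\<alpha> \<in> carrier Q" "\<beta> \<in> carrier Q" "\<gamma>' \<in> carrier R" "red \<beta> \<alpha> \<gamma>'" "\<gamma> = nf \<gamma>'"
    using assms by (rule qredE)
  then have "nf (\<alpha> \<ominus> \<gamma>') \<in> nf ` (Idl {\<beta>})" using A2 Q_carrier by blast
  also have "\<dots> = Idl\<^bsub>Q\<^esub> {\<beta>}"
    using g(2) nf.surj_image_genideal[of "{\<beta>}", OF _ nf_image] Q_carrier nf_id by simp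
  finally show ?thesis using g nf_minus Q_carrier nf_id by simp
qed

lemma quotient_reduction_relation: "reduction_relation Q qred"
proof (intro reduction_relation.intro reduction_relation_axioms.intro ring_Q)
  fix \<alpha> \<beta> \<gamma>
  show "\<alpha> \<in> carrier Q \<and> \<gamma> \<in> carrier Q" if "qred \<beta> \<alpha> \<gamma>"
    using that by (simp add: quotient_red_def)
  show "qred \<alpha> \<alpha> \<zero>\<^bsub>Q\<^esub>" if "\<alpha> \<in> carrier Q - {\<zero>\<^bsub>Q\<^esub>}"
    \<comment> \<open>The step of (A3) in \<open>R\<close> ends in zero, which is its own normal
      form and the zero of \<open>Q\<close>.\<close>
    using that A3 Q_carrier nf.S.zero_closed nf_id unfolding quotient_red_def zero_Q by blast
  show "\<alpha> \<ominus>\<^bsub>Q\<^esub> \<gamma> \<in> Idl\<^bsub>Q\<^esub> {\<beta>}" if "qred \<beta> \<alpha> \<gamma>"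
    using that by (rule qred_A2)
qed (rule qred_set_terminating)

text \<open>(A4) in \<open>R\<close> speaks of the unnormalised result \<delta>' of the step from
  \<beta>; \<open>A4_reducible_nf\<close> then transfers reducibility from \<delta>' to its normal
  form \<delta>.\<close>

lemma quotient_axiom_A4:
  assumes "axiom_A4 R red"
  shows "axiom_A4 Q qred"
  unfolding axiom_A4_def
proof (intro ballI impI, elim conjE)
  fix \<alpha> \<beta> \<gamma> \<delta>
  assume c: "\<alpha> \<in> carrier Q" "\<beta> \<in> carrier Q" "\<gamma> \<in> carrier Q" "\<delta> \<in> carrier Q"
    and "reducible (qred \<beta>) \<alpha>" "qred \<gamma> \<beta> \<delta>"
  then obtain \<delta>' where d: "\<delta>' \<in> carrier R" "red \<gamma> \<beta> \<delta>'" "\<delta> = nf \<delta>'" and "reducible (red \<beta>) \<alpha>"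
    by (auto simp: reducible_qred_iff elim: qredE)
  then have "reducible (red \<gamma>) \<alpha> \<or> reducible (red \<delta>') \<alpha>"
    using assms c Q_carrier unfolding axiom_A4_def by blast
  then show "reducible (qred \<gamma>) \<alpha> \<or> reducible (qred \<delta>) \<alpha>"
    using A4_reducible_nf[OF assms c(1) d(1)] c d(3) by (auto simp: reducible_qred_iff)
qed

section \<open>Groebner bases of ideals of the quotient\<close>

text \<open>Adding \<open>B\<close> to \<open>F\<close> adds the kernel \<open>I\<close> of
  \<open>nf\<close>. So \<open>Idl (F \<union> B)\<close> is the full preimage of the ideal of
  \<open>F\<close> in \<open>Q\<close>.\<close>

lemma genideal_nf_preimage:
  assumes "F \<subseteq> carrier Q"
  shows "nf ` (Idl (F \<union> B)) = Idl\<^bsub>Q\<^esub> F"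
    and "\<lbrakk>x \<in> carrier R; nf x \<in> Idl\<^bsub>Q\<^esub> F\<rbrakk> \<Longrightarrow> x \<in> Idl (F \<union> B)"
proof -
  have FB: "F \<union> B \<subseteq> carrier R" using assms B_carrier Q_carrier by blast
  interpret J: ideal "Idl (F \<union> B)" R by (rule genideal_ideal[OF FB])
  interpret K: ideal "Idl\<^bsub>Q\<^esub> F" Q by (rule nf.S.genideal_ideal[OF assms])
  have IJ: "I \<subseteq> Idl (F \<union> B)"
    unfolding I_eq using genideal_self[OF FB] J.is_ideal by (intro genideal_minimal) auto
  have nfF: "nf ` F = F" using assms nf_id by force
  have nfB: "nf b = \<zero>\<^bsub>Q\<^esub>" if "b \<in> B" for b
    using that nf_I genideal_self[OF B_carrier] I_eq by blast
  have "Idl\<^bsub>Q\<^esub> (nf ` (F \<union> B)) = Idl\<^bsub>Q\<^esub> F"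
  proof
    show "Idl\<^bsub>Q\<^esub> (nf ` (F \<union> B)) \<subseteq> Idl\<^bsub>Q\<^esub> F"
      using nf.S.genideal_self[OF assms] nfF nfB
      by (intro nf.S.genideal_minimal[OF K.is_ideal]) (auto simp: image_Un)
    have "nf ` (F \<union> B) \<subseteq> carrier Q" using FB nf_in_Q by blast
    then show "Idl\<^bsub>Q\<^esub> F \<subseteq> Idl\<^bsub>Q\<^esub> (nf ` (F \<union> B))"
      using nf.S.genideal_self[of "nf ` (F \<union> B)"] nfF
      by (intro nf.S.genideal_minimal nf.S.genideal_ideal) blast+
  qed
  then show eq: "nf ` (Idl (F \<union> B)) = Idl\<^bsub>Q\<^esub> F"
    using nf.surj_image_genideal[OF FB nf_image] by simp
  assume x: "x \<in> carrier R" "nf x \<in> Idl\<^bsub>Q\<^esub> F"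
  then obtain y where y: "y \<in> Idl (F \<union> B)" "nf x = nf y" using eq by (metis imageE)
  then have yc: "y \<in> carrier R" by (simp add: J.Icarr)
  \<comment> \<open>Equal normal forms mean a difference in \<open>I\<close>, which is contained in
    this ideal.\<close>
  have "x \<ominus> y \<in> Idl (F \<union> B)" using nf_eq_iff[OF x(1) yc] y(2) IJ by blast
  then have "(x \<ominus> y) \<oplus> y \<in> Idl (F \<union> B)" using y(1) by (rule J.a_closed)
  moreover have "(x \<ominus> y) \<oplus> y = x" using x(1) yc by algebra
  ultimately show "x \<in> Idl (F \<union> B)" by simp
qed

lemma quotient_groebner_basis:
  assumes A4: "axiom_A4 R red" and F: "F \<subseteq> carrier Q"
    and finG: "finite G" and G: "groebner_basis R red G (Idl (F \<union> B))"
  shows "groebner_basis Q qred (nf ` G) (Idl\<^bsub>Q\<^esub> F)"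
proof -
  let ?J = "Idl\<^bsub>Q\<^esub> F" and ?r = "red_set qred (nf ` G)"
  interpret J: ideal ?J Q by (rule nf.S.genideal_ideal[OF F])
  interpret Q: reduction_relation Q qred by (rule quotient_reduction_relation)
  have GR: "G \<subseteq> carrier R" and GJ: "Idl (F \<union> B) = Idl G"
    and G_iff: "\<And>x y. \<lbrakk>x \<in> carrier R; y \<in> carrier R\<rbrakk>
        \<Longrightarrow> equivclp (red_set red G) x y \<longleftrightarrow> x \<ominus> y \<in> Idl (F \<union> B)"
    and G_conf: "confluentp (red_set red G)"
    using G by (auto simp: groebner_basis_def)
  have GQ: "nf ` G \<subseteq> carrier Q" using GR nf_in_Q by blast
  have J_eq: "?J = Idl\<^bsub>Q\<^esub> (nf ` G)"
    using genideal_nf_preimage(1)[OF F] nf.surj_image_genideal[OF GR nf_image] GJ by simp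
  have terminating_r: "terminating ?r" using finG GQ by (intro qred_set_terminating) auto
  \<comment> \<open>Congruence modulo \<open>?J\<close> is treated as equality of cosets, which
    makes it visibly an equivalence relation.\<close>
  note coset = nf.S.quotient_eq_iff_same_a_r_cos[OF J.is_ideal]

  have step: "x \<in> carrier Q \<and> y \<in> carrier Q \<and> ?J +>\<^bsub>Q\<^esub> x = ?J +>\<^bsub>Q\<^esub> y" if "?r x y" for x y
  proof -
    from that obtain g where g: "g \<in> nf ` G" "qred g x y" by (auto simp: red_set_def)
    have xy: "x \<in> carrier Q" "y \<in> carrier Q" using Q.red_set_closed[OF GQ that] by auto
    have "Idl\<^bsub>Q\<^esub> {g} \<subseteq> ?J"
      using g(1) nf.S.genideal_self[OF GQ] J_eq
      by (intro nf.S.genideal_minimal J.is_ideal) auto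
    then have "x \<ominus>\<^bsub>Q\<^esub> y \<in> ?J" using qred_A2[OF g(2)] by blast
    then show ?thesis using coset xy by simp
  qed
  have equiv: "y \<in> carrier Q \<and> ?J +>\<^bsub>Q\<^esub> x = ?J +>\<^bsub>Q\<^esub> y"
    if "equivclp ?r x y" "x \<in> carrier Q" for x y
    using that by (induction rule: equivclp_induct) (auto dest: step)

  have irreducible_eq: "x = y"
    if xy: "x \<in> carrier Q" "y \<in> carrier Q" and "\<not> reducible ?r x" "\<not> reducible ?r y"
      and eq: "?J +>\<^bsub>Q\<^esub> x = ?J +>\<^bsub>Q\<^esub> y" for x y
  proof -
    have irred: "\<not> reducible (red_set red G) z" if z: "z \<in> carrier Q" "\<not> reducible ?r z" for z
    proof
      assume "reducible (red_set red G) z"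
      then obtain g where g: "g \<in> G" "reducible (red g) z" by (auto simp: reducible_def red_set_def)
      then have "reducible (red (nf g)) z" using A4_reducible_nf[OF A4 z(1)] GR by blast
      then have "reducible (qred (nf g)) z" using reducible_qred_iff z(1) g(1) GQ by blast
      then show False using z(2) g(1) by (auto simp: reducible_def red_set_def)
    qed
    \<comment> \<open>Pulling the congruence back to \<open>R\<close> makes \<open>x\<close> and
      \<open>y\<close> convertible under \<open>G\<close>; being \<open>G\<close>-irreducible, they
      coincide.\<close>
    have "nf (x \<ominus> y) \<in> ?J" using eq xy coset nf_minus nf_id Q_carrier by simp
    then have "x \<ominus> y \<in> Idl (F \<union> B)"
      using genideal_nf_preimage(2)[OF F] xy Q_carrier by simp
    then have "equivclp (red_set red G) x y" using G_iff xy Q_carrier by simp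
    then show ?thesis using confluentp_irreducible_unique[OF G_conf] irred that by blast
  qed

  have joinable: "\<exists>u. ?r\<^sup>*\<^sup>* x u \<and> ?r\<^sup>*\<^sup>* y u"
    if xy: "x \<in> carrier Q" "y \<in> carrier Q" "?J +>\<^bsub>Q\<^esub> x = ?J +>\<^bsub>Q\<^esub> y" for x y
  proof -
    \<comment> \<open>Irreducible descendants of congruent elements remain congruent, hence are
      equal and serve as the common reduct.\<close>
    obtain x' y' where "?r\<^sup>*\<^sup>* x x'" "\<not> reducible ?r x'" "?r\<^sup>*\<^sup>* y y'" "\<not> reducible ?r y'"
      using terminating_reaches_irreducible[OF terminating_r] by metis
    moreover from this have "x' = y'"
      using equiv[OF rtranclp_into_equivclp] xy by (intro irreducible_eq) auto
    ultimately show ?thesis by blast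
  qed
  have "confluentp ?r"
  proof (rule confluentpI)
    fix x y z assume r: "?r\<^sup>*\<^sup>* x y" "?r\<^sup>*\<^sup>* x z"
    show "\<exists>u. ?r\<^sup>*\<^sup>* y u \<and> ?r\<^sup>*\<^sup>* z u"
    \<comment> \<open>Confluence is required on the whole type; elements outside
      \<open>carrier Q\<close> admit no steps at all.\<close>
    proof (cases "x \<in> carrier Q")
      case True
      then have "y \<in> carrier Q \<and> ?J +>\<^bsub>Q\<^esub> x = ?J +>\<^bsub>Q\<^esub> y"
        "z \<in> carrier Q \<and> ?J +>\<^bsub>Q\<^esub> x = ?J +>\<^bsub>Q\<^esub> z"
        using r equiv rtranclp_into_equivclp by metis+
      then show ?thesis using joinable by metis
    next
      case False
      then have "\<not> reducible ?r x" using step by (auto simp: reducible_def)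
      then show ?thesis using irreducible_rtranclp_eq r by metis
    qed
  qed
  moreover have "equivclp ?r x y \<longleftrightarrow> x \<ominus>\<^bsub>Q\<^esub> y \<in> ?J"
    if "x \<in> carrier Q" "y \<in> carrier Q" for x y
  proof
    assume "equivclp ?r x y"
    then show "x \<ominus>\<^bsub>Q\<^esub> y \<in> ?J" using equiv[of x y] coset that by simp
  next
    assume "x \<ominus>\<^bsub>Q\<^esub> y \<in> ?J"
    then have "?J +>\<^bsub>Q\<^esub> x = ?J +>\<^bsub>Q\<^esub> y" using coset[OF that] by (rule iffD1[rotated])
    from joinable[OF that this] obtain u where u: "?r\<^sup>*\<^sup>* x u" "?r\<^sup>*\<^sup>* y u" by (elim exE conjE)
    show "equivclp ?r x y"
      by (rule equivclp_trans[OF rtranclp_into_equivclp[OF u(1)]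
            converse_rtranclp_into_equivclp[OF u(2)]])
  qed
  ultimately show ?thesis
    unfolding groebner_basis_def by (intro conjI ballI GQ J_eq terminating_r) assumption+
qed

end

section \<open>Assembling the quotient theorem\<close>

lemma quotient_reduction_ring:
  fixes R (structure)
  assumes "reduction_ring R red" "axiom_A4 R red" "finite B" "groebner_basis R red B I"
  shows "reduction_ring (quotient_ring R red B) (quotient_red R red B)"
proof -
  interpret reduction_ring R red by fact
  interpret groebner_quotient R red B I
    using assms(3,4) by unfold_locales
  show ?thesis
  proof (intro reduction_ring.intro reduction_ring_axioms.intro quotient_reduction_relation)
    fix J assume "finitely_generated_ideal Q J"
    then obtain F where F: "finite F" "F \<subseteq> carrier Q" "J = Idl\<^bsub>Q\<^esub> F"
      by (auto simp: finitely_generated_ideal_def)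
    \<comment> \<open>The preimage in \<open>R\<close> of \<open>J\<close> is generated by the
      finite set \<open>F \<union> B\<close>, so it has a finite Groebner basis \<open>G\<close> in
      \<open>R\<close>; its normal forms serve for \<open>J\<close>.\<close>
    then have "finite (F \<union> B)" "F \<union> B \<subseteq> carrier R" using finite_B B_carrier Q_carrier by auto
    then have "finitely_generated_ideal R (Idl (F \<union> B))"
      unfolding finitely_generated_ideal_def by blast
    then obtain G where "finite G" "groebner_basis R red G (Idl (F \<union> B))"
      using finite_groebner_basis by blast
    then show "\<exists>G. finite G \<and> groebner_basis Q qred G J"
      using quotient_groebner_basis[OF assms(2) F(2)] F(3) by blast
  qed
qed

text \<open>The quotient is built from a chosen basis, so the result covers every choice; the first
  conjunct shows that a choice exists.\<close>

theorem theorem3p2p2: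
  fixes R :: "('a, 'm) ring_scheme" and red :: "'a \<Rightarrow> 'a \<Rightarrow> 'a \<Rightarrow> bool" and I :: "'a set"
  assumes "reduction_ring R red"
    and "axiom_A4 R red"
    and "finitely_generated_ideal R I"
  shows "(\<exists>B. finite B \<and> groebner_basis R red B I) \<and>
    (\<forall>B. finite B \<and> groebner_basis R red B I \<longrightarrow>
       reduction_ring (quotient_ring R red B) (quotient_red R red B) \<and>
       axiom_A4 (quotient_ring R red B) (quotient_red R red B))"
proof -
  interpret reduction_ring R red by fact
  have "axiom_A4 (quotient_ring R red B) (quotient_red R red B)"
    if "finite B" "groebner_basis R red B I" for B
  proof -
    interpret groebner_quotient R red B I using that by unfold_locales
    show ?thesis by (rule quotient_axiom_A4[OF assms(2)])
  qed
  then show ?thesis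
    using finite_groebner_basis[OF assms(3)] quotient_reduction_ring[OF assms(1,2)] by blast
qed

end
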